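(* Let $G$ be a (not necessarily finite) non-abelian group. Then the commuting graph $\Gamma_c(G)$ has no $3$-cycle if and only if $G$ is isomorphic to the symmetric group $S_3$, the quaternion group $Q_8$ of order $8$, or the dihedral group $D_8$ of order $8$.
   Context: For a non-abelian group $G$ with center $Z(G)$, the commuting graph $\Gamma_c(G)$ is the simple undirected graph with vertex set $G\setminus Z(G)$, in which two distinct vertices $x,y$ are adjacent if and only if $xy=yx$. A $3$-cycle (triangle) is a cycle of length $3$. *)

theory Defs
  imports "HOL-Algebra.Sym_Groups" "Graph_Theory.Pair_Digraph"
begin

definition center :: "('a, 'b) monoid_scheme \<Rightarrow> 'a set" where
  "center G = {z \<in> carrier G. \<forall>x \<in> carrier G. z \<otimes>\<^bsub>G\<^esub> x = x \<otimes>\<^bsub>G\<^esub> z}"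

text \<open>
  A simple undirected graph is rendered as a loop-free symmetric digraph without parallel arcs:
  an edge between \<open>x\<close> and \<open>y\<close> is the pair of arcs \<open>(x, y)\<close> and \<open>(y, x)\<close>. Finiteness is not required.
\<close>

definition commuting_graph :: "('a, 'b) monoid_scheme \<Rightarrow> 'a pair_pre_digraph" where
  "commuting_graph G =
     \<lparr> pverts = carrier G - center G,
       parcs = {(x, y). x \<in> carrier G - center G \<and> y \<in> carrier G - center G \<and>
                        x \<noteq> y \<and> x \<otimes>\<^bsub>G\<^esub> y = y \<otimes>\<^bsub>G\<^esub> x} \<rparr>"

lemma pair_bidirected_digraph_commuting_graph: "pair_bidirected_digraph (commuting_graph G)"
  by unfold_locales (auto simp: commuting_graph_def symmetric_def sym_def)

text \<open>
  The library's directed cycles may have length 2 (running along an edge and back), but a cycle of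
  length 3 in a symmetric digraph is the same thing as a 3-cycle of the undirected graph.
\<close>

definition has_3_cycle :: "'a pair_pre_digraph \<Rightarrow> bool" where
  "has_3_cycle \<Gamma> \<longleftrightarrow> (\<exists>p. pre_digraph.cycle (with_proj \<Gamma>) p \<and> length p = 3)"

lemma has_3_cycle_iff:
  assumes "pair_wf_digraph \<Gamma>"
  shows "has_3_cycle \<Gamma> \<longleftrightarrow>
    (\<exists>a b c. (a, b) \<in> parcs \<Gamma> \<and> (b, c) \<in> parcs \<Gamma> \<and> (c, a) \<in> parcs \<Gamma> \<and> distinct [a, b, c])"
proof -
  interpret pair_wf_digraph \<Gamma> by fact
  show ?thesis
  proof
    assume "has_3_cycle \<Gamma>"
    then obtain p u where p: "awalk u p u" "distinct (tl (pawalk_verts u p))" "length p = 3"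
      by (auto simp: has_3_cycle_def cycle_def)
    then obtain a b c a' b' c' where "p = [(a, a'), (b, b'), (c, c')]"
      by (auto simp: numeral_3_eq_3 length_Suc_conv)
    with p have "(a, b) \<in> parcs \<Gamma> \<and> (b, c) \<in> parcs \<Gamma> \<and> (c, a) \<in> parcs \<Gamma> \<and> distinct [a, b, c]"
      by (auto simp: awalk_def)
    then show "\<exists>a b c. (a, b) \<in> parcs \<Gamma> \<and> (b, c) \<in> parcs \<Gamma> \<and> (c, a) \<in> parcs \<Gamma> \<and> distinct [a, b, c]"
      by blast
  next
    assume "\<exists>a b c. (a, b) \<in> parcs \<Gamma> \<and> (b, c) \<in> parcs \<Gamma> \<and> (c, a) \<in> parcs \<Gamma> \<and> distinct [a, b, c]"
    then obtain a b c where "(a, b) \<in> parcs \<Gamma>" "(b, c) \<in> parcs \<Gamma>" "(c, a) \<in> parcs \<Gamma>" "distinct [a, b, c]"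
      by blast
    then have "cycle [(a, b), (b, c), (c, a)]"
      by (auto simp: cycle_def awalk_def intro: in_arcsD1)
    then show "has_3_cycle \<Gamma>"
      unfolding has_3_cycle_def by (intro exI[of _ "[(a, b), (b, c), (c, a)]"]) simp
  qed
qed

text \<open>
  The dihedral group of order \<open>2n\<close>, generated by \<open>r\<close> and \<open>s\<close> subject to
  \<open>r\<^sup>n = s\<^sup>2 = 1\<close> and \<open>s r = r\<^sup>-\<^sup>1 s\<close>. The pair \<open>(i, e)\<close> stands for the element \<open>r\<^sup>i s\<^sup>e\<close>,
  where the truth value \<open>e\<close> is read as an exponent 0 or 1.
\<close>

definition dihedral_group :: "nat \<Rightarrow> (int \<times> bool) monoid" where
  "dihedral_group n =
     \<lparr> carrier = {0..<int n} \<times> UNIV,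
       mult = (\<lambda>(i, e) (j, f). ((if e then i - j else i + j) mod int n, e \<noteq> f)),
       one = (0, False) \<rparr>"

text \<open>
  A quadruple \<open>(a, b, c, d)\<close> stands for the quaternion \<open>a + b i + c j + d k\<close>;
  the multiplication is the Hamilton product.
\<close>

type_synonym int_quaternion = "int \<times> int \<times> int \<times> int"

definition quaternion_mult :: "int_quaternion \<Rightarrow> int_quaternion \<Rightarrow> int_quaternion" where
  "quaternion_mult = (\<lambda>(a, b, c, d) (a', b', c', d').
     (a * a' - b * b' - c * c' - d * d',
      a * b' + b * a' + c * d' - d * c',
      a * c' - b * d' + c * a' + d * b',
      a * d' + b * c' - c * b' + d * a'))"

definition quaternion_group :: "int_quaternion monoid" where
  "quaternion_group =
     \<lparr> carrier = {(1, 0, 0, 0), (-1, 0, 0, 0), (0, 1, 0, 0), (0, -1, 0, 0),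
                  (0, 0, 1, 0), (0, 0, -1, 0), (0, 0, 0, 1), (0, 0, 0, -1)},
       mult = quaternion_mult,
       one = (1, 0, 0, 0) \<rparr>"

lemma group_dihedral_group:
  assumes "n > 0"
  shows "group (dihedral_group n)"
proof (rule groupI)
  fix x y z assume "x \<in> carrier (dihedral_group n)" "y \<in> carrier (dihedral_group n)"
    "z \<in> carrier (dihedral_group n)"
  then show "x \<otimes>\<^bsub>dihedral_group n\<^esub> y \<otimes>\<^bsub>dihedral_group n\<^esub> z =
             x \<otimes>\<^bsub>dihedral_group n\<^esub> (y \<otimes>\<^bsub>dihedral_group n\<^esub> z)"
    by (cases x; cases y; cases z) (simp add: dihedral_group_def mod_simps
        add.assoc diff_diff_eq diff_diff_eq2 diff_add_eq add_diff_eq)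
next
  fix x assume x: "x \<in> carrier (dihedral_group n)"
  obtain i e where ie: "x = (i, e)" by fastforce
  show "\<exists>y \<in> carrier (dihedral_group n). y \<otimes>\<^bsub>dihedral_group n\<^esub> x = \<one>\<^bsub>dihedral_group n\<^esub>"
    using x assms
    by (intro bexI[of _ "(if e then i else (- i) mod int n, e)"])
       (auto simp: dihedral_group_def ie mod_simps)
qed (use assms in \<open>auto simp: dihedral_group_def split: prod.splits\<close>)

lemma order_dihedral_group: "order (dihedral_group n) = 2 * n"
  by (simp add: order_def dihedral_group_def)

lemma quaternion_mult_assoc:
  "quaternion_mult (quaternion_mult x y) z = quaternion_mult x (quaternion_mult y z)"
proof -
  obtain a b c d a' b' c' d' a'' b'' c'' d''
    where "x = (a, b, c, d)" "y = (a', b', c', d')" "z = (a'', b'', c'', d'')"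
    by (metis prod.exhaust)
  moreover have "quaternion_mult (quaternion_mult (a, b, c, d) (a', b', c', d')) (a'', b'', c'', d'') =
    quaternion_mult (a, b, c, d) (quaternion_mult (a', b', c', d') (a'', b'', c'', d''))"
    unfolding quaternion_mult_def case_prod_conv prod.inject by (intro conjI; algebra)
  ultimately show ?thesis by simp
qed

lemma group_quaternion_group: "group quaternion_group"
proof -
  have closed: "\<forall>x \<in> carrier quaternion_group. \<forall>y \<in> carrier quaternion_group.
      x \<otimes>\<^bsub>quaternion_group\<^esub> y \<in> carrier quaternion_group"
    and inverse: "\<forall>x \<in> carrier quaternion_group. \<exists>y \<in> carrier quaternion_group.
      y \<otimes>\<^bsub>quaternion_group\<^esub> x = \<one>\<^bsub>quaternion_group\<^esub>"
    and one: "\<forall>x \<in> carrier quaternion_group. \<one>\<^bsub>quaternion_group\<^esub> \<otimes>\<^bsub>quaternion_group\<^esub> x = x"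
    by (simp_all add: quaternion_group_def quaternion_mult_def)
  have "\<one>\<^bsub>quaternion_group\<^esub> \<in> carrier quaternion_group"
    by (simp add: quaternion_group_def)
  with closed inverse one show ?thesis
    by (intro groupI) (blast, blast, simp add: quaternion_group_def quaternion_mult_assoc, blast+)
qed

lemma order_quaternion_group: "order quaternion_group = 8"
  by (simp add: order_def quaternion_group_def)

end

theory Submission
  imports Defs "HOL-Algebra.Multiplicative_Group"
begin

text \<open>
  If \<open>x\<close> is not central and \<open>Z\<close> is the center, then the coset \<open>x Z\<close> is a clique of the commuting
  graph, so without triangles \<open>|Z| \<le> 2\<close>.
  If \<open>Z = {1, z}\<close>, then every noncentral \<open>x\<close> has centralizer \<open>{1, z, x, x z}\<close>. Hence all squares are
  central, and some \<open>r\<close> with \<open>r\<^sup>2 = z\<close> is inverted by every element that does not commute with it.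
  If \<open>Z\<close> is trivial, then the centralizer of \<open>x\<close> is \<open>{1, x, x\<^sup>-\<^sup>1}\<close>, so that \<open>x\<close> has order 2 or 3. Both
  orders occur, and each involution inverts each element of order 3.
  In both cases \<open>G\<close> consists of the powers of one element and one coset of inverting elements.
\<close>

section \<open>Centralizers and the center\<close>

context group
begin

text \<open>Once products are associated to the right, a pair of inverse factors is usually followed
  by a further factor; these rules let the simplifier cancel such a pair.\<close>

lemma inv_mult_cancel_left [simp]:
  assumes "x \<in> carrier G" "y \<in> carrier G"
  shows "inv x \<otimes> (x \<otimes> y) = y" and "x \<otimes> (inv x \<otimes> y) = y"
  using assms by (simp_all flip: m_assoc)

text \<open>The step from an element to its inverse gives both directions, since it applies to
  \<open>x\<close> as well as to \<open>inv x\<close>.\<close>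

lemma commutes_inv_iff:
  assumes "x \<in> carrier G" "y \<in> carrier G"
  shows "inv x \<otimes> y = y \<otimes> inv x \<longleftrightarrow> x \<otimes> y = y \<otimes> x"
proof -
  have "inv x \<otimes> y = y \<otimes> inv x" if "x \<in> carrier G" "x \<otimes> y = y \<otimes> x" for x
  proof -
    have "inv x \<otimes> y = inv x \<otimes> (y \<otimes> x) \<otimes> inv x"
      using that(1) assms by (simp add: m_assoc)
    also have "\<dots> = y \<otimes> inv x"
      using that(1) assms by (simp add: m_assoc flip: that(2))
    finally show ?thesis .
  qed
  from this[of x] this[of "inv x"] show ?thesis
    using assms by auto
qed

lemma subgroup_centralizer:
  assumes "a \<in> carrier G"
  shows "subgroup {x \<in> carrier G. x \<otimes> a = a \<otimes> x} G"
proof (rule subgroupI)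
  fix x assume "x \<in> {x \<in> carrier G. x \<otimes> a = a \<otimes> x}"
  then show "inv x \<in> {x \<in> carrier G. x \<otimes> a = a \<otimes> x}"
    using assms by (simp add: commutes_inv_iff)
next
  fix x y assume "x \<in> {x \<in> carrier G. x \<otimes> a = a \<otimes> x}" "y \<in> {x \<in> carrier G. x \<otimes> a = a \<otimes> x}"
  then show "x \<otimes> y \<in> {x \<in> carrier G. x \<otimes> a = a \<otimes> x}"
    using assms by (simp add: m_assoc) (simp flip: m_assoc)
qed (use assms in auto)

text \<open>Replaces the graph by equations: from here on a triangle is three distinct noncentral
  elements that commute pairwise.\<close>

lemma has_3_cycle_commuting_graph_iff:
  "has_3_cycle (commuting_graph G) \<longleftrightarrow>
    (\<exists>a b c. {a, b, c} \<subseteq> carrier G - center G \<and> distinct [a, b, c] \<and>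
      a \<otimes> b = b \<otimes> a \<and> b \<otimes> c = c \<otimes> b \<and> a \<otimes> c = c \<otimes> a)"
proof -
  interpret pair_bidirected_digraph "commuting_graph G"
    by (rule pair_bidirected_digraph_commuting_graph)
  have "has_3_cycle (commuting_graph G) \<longleftrightarrow>
    (\<exists>a b c. (a, b) \<in> parcs (commuting_graph G) \<and> (b, c) \<in> parcs (commuting_graph G) \<and>
      (c, a) \<in> parcs (commuting_graph G) \<and> distinct [a, b, c])"
    by (rule has_3_cycle_iff) (rule pair_wf_digraph_axioms)
  also have "\<dots> \<longleftrightarrow>
    (\<exists>a b c. {a, b, c} \<subseteq> carrier G - center G \<and> distinct [a, b, c] \<and>
      a \<otimes> b = b \<otimes> a \<and> b \<otimes> c = c \<otimes> b \<and> a \<otimes> c = c \<otimes> a)"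
    by (intro ex_cong1) (auto simp: commuting_graph_def)
  finally show ?thesis .
qed

text \<open>The centralizer of a vertex of a triangle contains the center and the triangle, and by
  Lagrange's theorem a proper subgroup has at most half the elements.\<close>

lemma no_3_cycle_if_order_less:
  assumes "order G < 2 * (card (center G) + 3)" and "finite (carrier G)"
  shows "\<not> has_3_cycle (commuting_graph G)"
proof
  assume "has_3_cycle (commuting_graph G)"
  then obtain a b c where abc: "{a, b, c} \<subseteq> carrier G - center G" "distinct [a, b, c]"
    "a \<otimes> b = b \<otimes> a" "a \<otimes> c = c \<otimes> a"
    unfolding has_3_cycle_commuting_graph_iff by blast
  define C where "C = {x \<in> carrier G. x \<otimes> a = a \<otimes> x}"
  have sub: "subgroup C G"
    using abc unfolding C_def by (intro subgroup_centralizer) auto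
  then have C: "C \<subseteq> carrier G" by (rule subgroup.subset)
  have "center G \<subseteq> C"
    using abc by (auto simp: C_def center_def)
  moreover have "{a, b, c} \<subseteq> C"
    using abc by (auto simp: C_def)
  ultimately have "card (center G \<union> {a, b, c}) \<le> card C"
    using C assms by (intro card_mono) (auto intro: finite_subset)
  moreover have "card (center G \<union> {a, b, c}) = card (center G) + card {a, b, c}"
    using abc assms by (intro card_Un_disjoint) (auto simp: center_def)
  moreover have "card {a, b, c} = 3"
    using abc by simp
  ultimately have ge: "card (center G) + 3 \<le> card C" by simp
  obtain y where "y \<in> carrier G" "y \<otimes> a \<noteq> a \<otimes> y"
    using abc by (auto simp: center_def)
  then have "C \<noteq> carrier G"
    by (auto simp: C_def)
  then have "card C < order G"
    using C assms by (simp add: order_def psubset_card_mono)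
  moreover have "card (rcosets C) * card C = order G"
    using lagrange[OF sub] by simp
  ultimately have "1 * card C < card (rcosets C) * card C"
    by simp
  then have "2 \<le> card (rcosets C)"
    by (simp only: mult_less_cancel2) simp
  then have "2 * card C \<le> order G"
    unfolding \<open>card (rcosets C) * card C = order G\<close>[symmetric] by (rule mult_le_mono1)
  with ge assms show False by simp
qed

lemma one_in_center: "\<one> \<in> center G"
  by (simp add: center_def)

lemma center_closed: "z \<in> center G \<Longrightarrow> z \<in> carrier G"
  by (simp add: center_def)

lemma not_centralE:
  assumes "x \<in> carrier G" "x \<notin> center G"
  obtains y where "y \<in> carrier G" "x \<otimes> y \<noteq> y \<otimes> x"
  using assms by (auto simp: center_def)

lemma center_commute: "z \<in> center G \<Longrightarrow> x \<in> carrier G \<Longrightarrow> z \<otimes> x = x \<otimes> z"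
  by (simp add: center_def)

lemma center_left_commute:
  assumes "z \<in> center G" "x \<in> carrier G" "y \<in> carrier G"
  shows "z \<otimes> (x \<otimes> y) = x \<otimes> (z \<otimes> y)"
proof -
  have zx: "z \<in> carrier G" "z \<otimes> x = x \<otimes> z"
    using assms by (auto simp: center_def)
  have "z \<otimes> (x \<otimes> y) = (z \<otimes> x) \<otimes> y"
    using zx(1) assms by (simp add: m_assoc)
  also have "\<dots> = x \<otimes> (z \<otimes> y)"
    unfolding zx(2) using zx(1) assms by (simp add: m_assoc)
  finally show ?thesis .
qed

lemma center_mult_closed:
  assumes "z \<in> center G" "w \<in> center G"
  shows "z \<otimes> w \<in> center G"
proof -
  have "z \<otimes> w \<otimes> x = x \<otimes> (z \<otimes> w)" if "x \<in> carrier G" for x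
    using that assms[THEN center_closed] center_commute[of w x] center_left_commute[of z x w] assms
    by (simp add: m_assoc)
  then show ?thesis
    using assms[THEN center_closed] by (simp add: center_def)
qed

lemma not_in_center_if_not_commute:
  assumes "x \<in> carrier G" "y \<in> carrier G" "x \<otimes> y \<noteq> y \<otimes> x"
  shows "x \<notin> center G"
  using assms by (auto simp: center_def)

end

section \<open>Extensions of a cyclic group by an inverting element\<close>

text \<open>As in the dihedral group, \<open>(i, e)\<close> stands for \<open>r\<^sup>i s\<^sup>e\<close>, but now \<open>s\<^sup>2 = r\<^sup>k\<close>. This is
  a group only if \<open>n\<close> divides \<open>2k\<close>.\<close>

definition dicyclic :: "nat \<Rightarrow> nat \<Rightarrow> (int \<times> bool) monoid" where
  "dicyclic n k =
     \<lparr> carrier = {0..<int n} \<times> UNIV,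
       mult = (\<lambda>(i, e) (j, f).
         (((if e then i - j else i + j) + (if e \<and> f then int k else 0)) mod int n, e \<noteq> f)),
       one = (0, False) \<rparr>"

lemma dicyclic_0: "dicyclic n 0 = dihedral_group n"
  unfolding dicyclic_def dihedral_group_def by (simp cong: if_cong)

lemma dicyclic_mult_closed:
  assumes "n > 0"
  shows "x \<otimes>\<^bsub>dicyclic n k\<^esub> y \<in> carrier (dicyclic n k)"
  using assms by (cases x; cases y) (simp add: dicyclic_def)

text \<open>Stated for bare structures so that it applies to \<open>dicyclic n k\<close> without
  checking the group axioms there. Closure of \<open>H\<close> keeps the product of two preimages in
  the set on which \<open>h\<close> is injective.\<close>

lemma iso_sym_if_mult_closed:
  assumes "H \<cong> G"
    and "\<And>x y. x \<in> carrier H \<Longrightarrow> y \<in> carrier H \<Longrightarrow> x \<otimes>\<^bsub>H\<^esub> y \<in> carrier H"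
  shows "G \<cong> H"
proof -
  obtain h where h: "h \<in> hom H G" "bij_betw h (carrier H) (carrier G)"
    using assms by (auto simp: is_iso_def iso_def)
  let ?g = "inv_into (carrier H) h"
  have bij: "bij_betw ?g (carrier G) (carrier H)"
    using h by (simp add: bij_betw_inv_into)
  have "?g (x \<otimes>\<^bsub>G\<^esub> y) = ?g x \<otimes>\<^bsub>H\<^esub> ?g y" if "x \<in> carrier G" "y \<in> carrier G" for x y
  proof -
    have "?g x \<in> carrier H" "?g y \<in> carrier H"
      using bij that by (auto simp: bij_betw_def)
    moreover from this have "h (?g x \<otimes>\<^bsub>H\<^esub> ?g y) = x \<otimes>\<^bsub>G\<^esub> y"
      using h that by (simp add: hom_mult bij_betw_inv_into_right)
    ultimately show ?thesis
      using h assms(2) by (metis bij_betw_inv_into_left)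
  qed
  then have "?g \<in> iso G H"
    using bij by (auto simp: iso_def hom_def bij_betw_def)
  then show ?thesis by (rule is_isoI)
qed

context group
begin

text \<open>The hypothesis says that conjugation by \<open>s\<close> inverts \<open>r\<close>. It
  then also inverts \<open>inv r\<close>, and conjugation by \<open>inv s\<close>, being the inverse
  map, inverts \<open>r\<close> as well.\<close>

lemma inverts_inv:
  assumes "r \<in> carrier G" "s \<in> carrier G" "s \<otimes> r = inv r \<otimes> s"
  shows "s \<otimes> inv r = r \<otimes> s" and "inv s \<otimes> r = inv r \<otimes> inv s"
proof -
  have "r \<otimes> s = r \<otimes> (s \<otimes> r) \<otimes> inv r"
    using assms(1,2) by (simp add: m_assoc)
  also have "\<dots> = s \<otimes> inv r"
    unfolding assms(3) using assms(1,2) by (simp add: m_assoc)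
  finally show swap: "s \<otimes> inv r = r \<otimes> s" by simp
  have "inv s \<otimes> r = inv s \<otimes> (r \<otimes> s) \<otimes> inv s"
    using assms(1,2) by (simp add: m_assoc)
  also have "\<dots> = inv r \<otimes> inv s"
    using assms(1,2) by (simp add: m_assoc flip: swap)
  finally show "inv s \<otimes> r = inv r \<otimes> inv s" .
qed

lemma inverting_int_pow:
  fixes j :: int
  assumes rs: "r \<in> carrier G" "s \<in> carrier G" "s \<otimes> r = inv r \<otimes> s"
  shows "s \<otimes> r [^] j = r [^] (- j) \<otimes> s"
proof (induction j rule: int_induct[where k = 0])
  case base
  then show ?case using rs by simp
next
  case (step1 j)
  have "s \<otimes> r [^] (j + 1) = (s \<otimes> r [^] j) \<otimes> r"
    using rs by (simp add: int_pow_mult m_assoc)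
  also have "\<dots> = r [^] (- j) \<otimes> (s \<otimes> r)"
    using rs step1 by (simp add: m_assoc)
  also have "\<dots> = r [^] (- (j + 1)) \<otimes> s"
    using rs int_pow_diff[of r "- j" 1] by (simp del: int_pow_neg add: m_assoc)
  finally show ?case by simp
next
  case (step2 j)
  have "s \<otimes> r [^] (j - 1) = (s \<otimes> r [^] j) \<otimes> inv r"
    using rs by (simp add: int_pow_diff m_assoc)
  also have "\<dots> = r [^] (- j) \<otimes> (r \<otimes> s)"
    using rs step2 inverts_inv(1)[OF rs] by (simp add: m_assoc)
  also have "\<dots> = r [^] (- (j - 1)) \<otimes> s"
    using rs int_pow_mult[of r "- j" 1] by (simp del: int_pow_neg add: m_assoc add.commute)
  finally show ?case by simp
qed

text \<open>Normal forms multiply in \<open>G\<close> exactly as in \<open>dicyclic n k\<close>,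
  because moving \<open>s\<close> past a power of \<open>r\<close> negates the exponent. Both
  recognition criteria below start from this embedding and add surjectivity.\<close>

lemma dicyclic_mon:
  assumes rs: "r \<in> carrier G" "s \<in> carrier G" "s \<otimes> r = inv r \<otimes> s" "s \<otimes> r \<noteq> r \<otimes> s"
    and ss: "s \<otimes> s = r [^] k" and n: "ord r = n" "n > 0"
  shows "(\<lambda>(i, e). r [^] i \<otimes> (if e then s else \<one>)) \<in> mon (dicyclic n k) G" (is "?f \<in> _")
proof -
  have pow_mod: "r [^] (i mod int n) = r [^] i" for i :: int
    using rs n by (simp add: int_pow_eq minus_mod_eq_mult_div)
  have swap: "s \<otimes> (r [^] j \<otimes> u) = r [^] (- j) \<otimes> (s \<otimes> u)" if "u \<in> carrier G" for j :: int and u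
    using rs that inverting_int_pow[of r s j] by (simp flip: m_assoc)
  have "?f (x \<otimes>\<^bsub>dicyclic n k\<^esub> y) = ?f x \<otimes> ?f y" for x y
  proof -
    obtain i e j f where "x = (i, e)" "y = (j, f)" by fastforce
    then show ?thesis
      using rs ss by (cases e; cases f)
        (simp_all add: dicyclic_def pow_mod swap inverting_int_pow[OF rs(1-3)] m_assoc int_pow_mult int_pow_diff int_pow_neg int_pow_int)
  qed
  moreover have "?f x \<in> carrier G" for x
    using rs by (auto split: prod.split)
  ultimately have "?f \<in> hom (dicyclic n k) G"
    by (intro homI) auto
  moreover have "inj_on ?f (carrier (dicyclic n k))"
  proof (rule inj_onI, clarify)
    fix i e j f
    assume *: "(i, e) \<in> carrier (dicyclic n k)" "(j, f) \<in> carrier (dicyclic n k)"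
      "r [^] i \<otimes> (if e then s else \<one>) = r [^] j \<otimes> (if f then s else \<one>)"
    \<comment> \<open>Powers of \<open>r\<close> commute with \<open>r\<close>, but \<open>s\<close>
      does not.\<close>
    have nopow: "s \<noteq> r [^] m" for m :: int
      using rs by (metis int_pow_mult int_pow_1 add.commute)
    have "e = f"
    proof (rule ccontr)
      assume "e \<noteq> f"
      then have "r [^] i \<otimes> s = r [^] j \<or> r [^] j \<otimes> s = r [^] i"
        using * rs by (auto split: if_splits)
      then have "s = inv (r [^] i) \<otimes> r [^] j \<or> s = inv (r [^] j) \<otimes> r [^] i"
        using rs by (metis int_pow_closed inv_solve_left)
      then show False
        using nopow rs by (metis int_pow_mult int_pow_neg)
    qed
    with * have "r [^] i = r [^] j"
      using rs by (auto split: if_splits)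
    then have "int n dvd j - i"
      using rs n by (simp add: int_pow_eq)
    \<comment> \<open>Both exponents lie between 0 and \<open>n - 1\<close>, so congruence modulo
      \<open>n\<close> is equality.\<close>
    with * have "i = j"
      by (simp add: dicyclic_def) (metis mod_eq_dvd_iff mod_pos_pos_trivial)
    with \<open>e = f\<close> show "i = j \<and> e = f" by simp
  qed
  ultimately show ?thesis by (simp add: mon_def)
qed

text \<open>Criterion for a concrete group whose order is known: an injective map between finite
  sets of equal size is onto.\<close>

lemma iso_dicyclic_if_order:
  assumes "r \<in> carrier G" "s \<in> carrier G" "s \<otimes> r = inv r \<otimes> s" "s \<otimes> r \<noteq> r \<otimes> s"
    and "s \<otimes> s = r [^] k" "ord r = n" "n > 0" and order: "order G = 2 * n"
  shows "dicyclic n k \<cong> G"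
proof -
  obtain h where h: "h \<in> mon (dicyclic n k) G"
    using dicyclic_mon assms by blast
  have "h ` carrier (dicyclic n k) = carrier G"
  proof (rule card_subset_eq)
    show "finite (carrier G)"
      using order \<open>n > 0\<close> by (intro card_ge_0_finite) (simp add: order_def)
    show "h ` carrier (dicyclic n k) \<subseteq> carrier G"
      using h by (auto simp: mon_def hom_def)
    show "card (h ` carrier (dicyclic n k)) = card (carrier G)"
      using h order by (simp add: mon_def card_image order_def) (simp add: dicyclic_def)
  qed
  with h show ?thesis
    by (auto simp: mon_def iso_iff intro!: is_isoI)
qed

text \<open>Criterion for an abstract \<open>G\<close> of unknown size. If \<open>x\<close> does not
  commute with \<open>r\<close>, then \<open>x\<close> and \<open>s\<close> both invert
  \<open>r\<close>, so \<open>x \<otimes> inv s\<close> centralizes \<open>r\<close> and is a power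
  of it; hence \<open>x\<close> lies in the coset of \<open>s\<close>.\<close>

lemma iso_dicyclic_if_inverting:
  assumes rs: "r \<in> carrier G" "s \<in> carrier G" "s \<otimes> r = inv r \<otimes> s" "s \<otimes> r \<noteq> r \<otimes> s"
    and ss: "s \<otimes> s = r [^] k" and n: "ord r = n" "n > 0"
    and cent: "\<And>x. x \<in> carrier G \<Longrightarrow> x \<otimes> r = r \<otimes> x \<Longrightarrow> \<exists>i::int. x = r [^] i"
    and inverts: "\<And>x. x \<in> carrier G \<Longrightarrow> x \<otimes> r \<noteq> r \<otimes> x \<Longrightarrow> x \<otimes> r = inv r \<otimes> x"
  shows "G \<cong> dicyclic n k"
proof -
  let ?f = "\<lambda>(i :: int, e). r [^] i \<otimes> (if e then s else \<one>)"
  have "x \<in> ?f ` carrier (dicyclic n k)" if x: "x \<in> carrier G" for x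
  proof -
    have "\<exists>i :: int. x = r [^] i \<or> x = r [^] i \<otimes> s"
    proof (cases "x \<otimes> r = r \<otimes> x")
      case True
      then show ?thesis using cent x by blast
    next
      case False
      have "(x \<otimes> inv s) \<otimes> r = (x \<otimes> inv r) \<otimes> inv s"
        using inverts_inv(2)[OF rs(1-3)] x rs(1,2) by (simp add: m_assoc)
      also have "x \<otimes> inv r = r \<otimes> x"
        using inverts_inv(1)[OF rs(1) x inverts[OF x False]] .
      finally have "(x \<otimes> inv s) \<otimes> r = r \<otimes> (x \<otimes> inv s)"
        using x rs by (simp add: m_assoc)
      then obtain i :: int where "x \<otimes> inv s = r [^] i"
        using cent x rs by (meson inv_closed m_closed)
      then have "x = r [^] i \<otimes> s"
        using x rs by (metis inv_solve_right int_pow_closed inv_closed inv_inv)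
      then show ?thesis by blast
    qed
    then obtain i :: int where "x = ?f (i, False) \<or> x = ?f (i, True)"
      using rs by auto
    then obtain e where "x = ?f (i, e)" by blast
    then have "x = ?f (i mod int n, e)"
      using rs n by (simp add: int_pow_eq) (metis int_pow_eq minus_mod_eq_mult_div dvd_triv_left)
    moreover have "(i mod int n, e) \<in> carrier (dicyclic n k)"
      using n by (simp add: dicyclic_def)
    ultimately show ?thesis by blast
  qed
  moreover have mon: "?f \<in> mon (dicyclic n k) G"
    by (rule dicyclic_mon[OF rs ss n])
  moreover have "?f ` carrier (dicyclic n k) \<subseteq> carrier G"
    using mon unfolding mon_def by (intro hom_carrier) simp
  ultimately have "?f \<in> iso (dicyclic n k) G"
    unfolding iso_iff mon_def by blast
  then have "dicyclic n k \<cong> G"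
    by (rule is_isoI)
  then show ?thesis
    by (rule iso_sym_if_mult_closed) (rule dicyclic_mult_closed[OF n(2)])
qed

section \<open>The quaternion group and S_3 as concrete instances\<close>

lemma ord_eq_3:
  assumes "x \<in> carrier G" "x [^] (3 :: nat) = \<one>" "x \<noteq> \<one>"
  shows "ord x = 3"
proof -
  have dvd: "ord x dvd 3" "ord x \<noteq> 1"
    using assms pow_eq_id ord_eq_1 by auto
  then have "ord x \<le> 3" by (simp add: dvd_imp_le)
  then have "ord x = 0 \<or> ord x = 1 \<or> ord x = 2 \<or> ord x = 3" by arith
  with dvd show ?thesis by auto
qed

lemma ord_eq_4:
  assumes "x \<in> carrier G" "x [^] (4 :: nat) = \<one>" "x [^] (2 :: nat) \<noteq> \<one>"
  shows "ord x = 4"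
proof -
  have dvd: "ord x dvd 4" "\<not> ord x dvd 2"
    using assms pow_eq_id by auto
  then have "ord x \<le> 4" by (simp add: dvd_imp_le)
  then have "ord x = 0 \<or> ord x = 1 \<or> ord x = 2 \<or> ord x = 3 \<or> ord x = 4" by arith
  with dvd show ?thesis by auto
qed

end

text \<open>Take i for \<open>r\<close> and j for \<open>s\<close>. Then j i = -i j, and the
  exponent 2 comes from j^2 = -1 = i^2.\<close>

lemma quaternion_group_iso: "dicyclic 4 2 \<cong> quaternion_group"
proof -
  interpret group quaternion_group by (rule group_quaternion_group)
  let ?i = "(0, 1, 0, 0) :: int_quaternion" and ?j = "(0, 0, 1, 0) :: int_quaternion"
  have mem: "?i \<in> carrier quaternion_group" "?j \<in> carrier quaternion_group"
    by (simp_all add: quaternion_group_def)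
  have "inv\<^bsub>quaternion_group\<^esub> ?i = (0, -1, 0, 0)"
    by (rule inv_equality) (simp_all add: quaternion_group_def quaternion_mult_def)
  moreover have "ord ?i = 4"
    using mem by (intro ord_eq_4)
      (simp_all add: numeral_eq_Suc, simp_all add: quaternion_group_def quaternion_mult_def)
  ultimately show ?thesis
    using mem by (intro iso_dicyclic_if_order[of ?i ?j])
      (simp_all add: order_quaternion_group numeral_2_eq_2,
       simp_all add: quaternion_group_def quaternion_mult_def)
qed

lemma order_sym_group_3: "order (sym_group 3) = 6"
  by (simp add: order_def sym_group_card_carrier fact_numeral)

text \<open>The product of the two transpositions is a 3-cycle, which serves as \<open>r\<close>;
  the transposition \<open>?s\<close> inverts it.\<close>

lemma sym_group_3_iso: "dicyclic 3 0 \<cong> sym_group 3"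
proof -
  interpret group "sym_group 3" by (rule sym_group_is_group)
  let ?s = "Transposition.transpose 1 2 :: nat \<Rightarrow> nat"
  let ?t = "Transposition.transpose 2 3 :: nat \<Rightarrow> nat"
  have mem: "?s \<in> carrier (sym_group 3)" "?t \<in> carrier (sym_group 3)" "?s \<circ> ?t \<in> carrier (sym_group 3)"
    by (auto simp: sym_group_carrier intro!: permutes_swap_id permutes_compose)
  have "inv\<^bsub>sym_group 3\<^esub> (?s \<circ> ?t) = ?t \<circ> ?s"
    using mem by (intro inv_equality) (auto simp: sym_group_def fun_eq_iff permutes_compose)
  moreover have "ord (?s \<circ> ?t) = 3"
    using mem by (intro ord_eq_3)
      (auto simp: numeral_3_eq_3 sym_group_mult sym_group_one fun_eq_iff transpose_def)
  moreover have "?s \<circ> (?s \<circ> ?t) = ?t \<circ> ?s \<circ> ?s"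
    by (simp add: fun_eq_iff)
  moreover have "?s \<circ> (?s \<circ> ?t) \<noteq> ?s \<circ> ?t \<circ> ?s"
    by (auto simp: fun_eq_iff transpose_def intro!: exI[of _ 1])
  moreover have "?s \<circ> ?s = id"
    by (simp add: fun_eq_iff)
  moreover have "order (sym_group 3) = 2 * 3"
    by (simp add: order_sym_group_3)
  ultimately show ?thesis
    using mem by (intro iso_dicyclic_if_order[of "?s \<circ> ?t" ?s])
      (simp_all only: sym_group_mult sym_group_one nat_pow_0, simp)
qed

section \<open>Groups with triangle-free commuting graph\<close>

context group
begin

lemma inv_eq_self: "x \<in> carrier G \<Longrightarrow> x \<otimes> x = \<one> \<Longrightarrow> inv x = x"
  by (rule inv_equality)

text \<open>The product equals its own inverse, which is \<open>inv y \<otimes> inv x\<close>, and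
  \<open>inv x = x\<close>.\<close>

lemma involution_prod:
  assumes "x \<in> carrier G" "y \<in> carrier G" "x \<otimes> x = \<one>" "(x \<otimes> y) \<otimes> (x \<otimes> y) = \<one>"
  shows "x \<otimes> y = inv y \<otimes> x"
  using assms by (metis inv_eq_self inv_mult_group m_closed)

lemma conj_commutes_iff:
  assumes "x \<in> carrier G" "y \<in> carrier G"
  shows "x \<otimes> y \<otimes> inv x = y \<longleftrightarrow> x \<otimes> y = y \<otimes> x"
  using assms by (metis inv_solve_right m_closed)

end

locale triangle_free_group = group G for G (structure) +
  assumes no_3_cycle: "\<not> has_3_cycle (commuting_graph G)"
begin

lemma no_triangle:
  assumes "a \<in> carrier G - center G" "b \<in> carrier G - center G" "c \<in> carrier G - center G"
    and "a \<noteq> b" "a \<noteq> c" "b \<noteq> c" "a \<otimes> b = b \<otimes> a" "b \<otimes> c = c \<otimes> b"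
  shows "a \<otimes> c \<noteq> c \<otimes> a"
  using no_3_cycle assms unfolding has_3_cycle_commuting_graph_iff by auto

text \<open>Any \<open>y\<close> that fails to commute with \<open>x\<close> also fails to commute
  with \<open>x \<otimes> z\<close>.\<close>

lemma mult_center_not_central:
  assumes "x \<in> carrier G - center G" "z \<in> center G"
  shows "x \<otimes> z \<in> carrier G - center G"
proof -
  obtain y where y: "y \<in> carrier G" "x \<otimes> y \<noteq> y \<otimes> x"
    using assms by (auto simp: center_def)
  have z: "z \<in> carrier G" "z \<otimes> y = y \<otimes> z"
    using assms y by (auto simp: center_def)
  have "(x \<otimes> z) \<otimes> y \<noteq> y \<otimes> (x \<otimes> z)"
    using y z assms by (metis DiffD1 m_assoc m_closed right_cancel)
  then show ?thesis
    using y z assms by (simp add: not_in_center_if_not_commute)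
qed

text \<open>For distinct \<open>z\<close> and \<open>w\<close> the elements \<open>x\<close>,
  \<open>x \<otimes> z\<close>, \<open>x \<otimes> w\<close> would form a triangle.\<close>

lemma center_unique:
  assumes "x \<in> carrier G - center G" "z \<in> center G - {\<one>}" "w \<in> center G - {\<one>}"
  shows "z = w"
proof (rule ccontr)
  assume "z \<noteq> w"
  have zw: "z \<in> carrier G" "w \<in> carrier G" "z \<otimes> w = w \<otimes> z" "z \<otimes> x = x \<otimes> z" "w \<otimes> x = x \<otimes> w"
    using assms by (blast intro: center_closed center_commute)+
  have "x \<otimes> z \<otimes> (x \<otimes> w) = x \<otimes> (x \<otimes> (z \<otimes> w))"
    using assms zw(1,2) center_left_commute[of z x w] by (simp add: m_assoc)
  also have "\<dots> = x \<otimes> w \<otimes> (x \<otimes> z)"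
    using assms zw(1,2) center_left_commute[of w x z] by (simp add: m_assoc zw(3))
  finally have "x \<otimes> z \<otimes> (x \<otimes> w) = x \<otimes> w \<otimes> (x \<otimes> z)" .
  moreover have "x \<otimes> (x \<otimes> z) = (x \<otimes> z) \<otimes> x" "x \<otimes> (x \<otimes> w) = (x \<otimes> w) \<otimes> x"
    using assms zw by (simp_all add: m_assoc)
  moreover have "x \<noteq> x \<otimes> z" "x \<noteq> x \<otimes> w" "x \<otimes> z \<noteq> x \<otimes> w"
    using assms zw \<open>z \<noteq> w\<close> by auto
  ultimately show False
    using no_triangle[of x "x \<otimes> z" "x \<otimes> w"] mult_center_not_central assms by simp
qed

section \<open>Center of order two\<close>

lemma iso_dicyclic_4:
  assumes nonabelian: "x0 \<in> carrier G - center G" and z: "z \<in> center G" "z \<noteq> \<one>"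
  shows "G \<cong> dicyclic 4 0 \<or> G \<cong> dicyclic 4 2"
proof -
  have zG: "z \<in> carrier G" and z_comm: "\<And>x. x \<in> carrier G \<Longrightarrow> z \<otimes> x = x \<otimes> z"
    using z by (auto simp: center_def)
  have center: "center G = {\<one>, z}"
    using center_unique[OF nonabelian] z one_in_center by blast
  have "z \<otimes> z \<in> {\<one>, z}"
    using center_mult_closed[OF z(1) z(1)] by (simp add: center)
  then have zz: "z \<otimes> z = \<one>"
    using zG z by auto
  \<comment> \<open>Any other \<open>y\<close> would form a triangle with \<open>x\<close> and
    \<open>x \<otimes> z\<close>.\<close>
  have cent: "y \<in> {\<one>, z, x, x \<otimes> z}"
    if x: "x \<in> carrier G - center G" and y: "y \<in> carrier G" "x \<otimes> y = y \<otimes> x" for x y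
  proof (rule ccontr)
    assume "y \<notin> {\<one>, z, x, x \<otimes> z}"
    moreover have "x \<otimes> (x \<otimes> z) = (x \<otimes> z) \<otimes> x" "(x \<otimes> z) \<otimes> y = y \<otimes> (x \<otimes> z)"
      using x y zG z_comm[of x] z_comm[of y] by (simp_all add: m_assoc) (simp add: y(2) flip: m_assoc)
    moreover have "x \<noteq> x \<otimes> z"
      using x zG z by auto
    ultimately show False
      using no_triangle[of x "x \<otimes> z" y] mult_center_not_central[OF x z(1)] x y
      by (auto simp: center)
  qed
  \<comment> \<open>The square of a noncentral \<open>x\<close> commutes with \<open>x\<close>; of
    the four candidates, \<open>x\<close> and \<open>x \<otimes> z\<close> would force
    \<open>x\<close> to be central.\<close>
  have square: "x \<otimes> x = \<one> \<or> x \<otimes> x = z" if "x \<in> carrier G" for x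
  proof (cases "x \<in> center G")
    case True
    then show ?thesis using zz by (auto simp: center)
  next
    case False
    then have "x \<otimes> x \<in> {\<one>, z, x, x \<otimes> z}"
      using cent[of x "x \<otimes> x"] that by (simp add: m_assoc)
    moreover have "x \<otimes> x \<noteq> x" "x \<otimes> x \<noteq> x \<otimes> z"
      using False that zG by (auto simp: center)
    ultimately show ?thesis by blast
  qed
  have "\<exists>r s. r \<in> carrier G \<and> s \<in> carrier G \<and> s \<otimes> r \<noteq> r \<otimes> s \<and> r \<otimes> r = z"
  proof -
    obtain x y where xy: "x \<in> carrier G" "y \<in> carrier G" "x \<otimes> y \<noteq> y \<otimes> x"
      using nonabelian by (auto simp: center_def)
    consider "x \<otimes> x = z" | "y \<otimes> y = z" | "x \<otimes> x = \<one>" "y \<otimes> y = \<one>"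
      using square xy by blast
    then show ?thesis
    proof cases
      \<comment> \<open>The product of two noncommuting involutions is not an involution, so its
        square is \<open>z\<close>; it serves as \<open>r\<close>, with \<open>x\<close> as
        \<open>s\<close>.\<close>
      case 3
      then have "(x \<otimes> y) \<otimes> (x \<otimes> y) \<noteq> \<one>"
        using involution_prod[of x y] inv_eq_self[of y] xy by auto
      then have "(x \<otimes> y) \<otimes> (x \<otimes> y) = z"
        using square xy by blast
      moreover have "x \<otimes> (x \<otimes> y) \<noteq> (x \<otimes> y) \<otimes> x"
        using xy by (simp add: m_assoc)
      ultimately show ?thesis
        using xy by blast
    qed (use xy in metis)+
  qed
  then obtain r s where rs: "r \<in> carrier G" "s \<in> carrier G" "s \<otimes> r \<noteq> r \<otimes> s" and rr: "r \<otimes> r = z"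
    by blast
  have r: "r \<in> carrier G - center G"
    using rs not_in_center_if_not_commute by auto
  \<comment> \<open>The squares of \<open>r \<otimes> x\<close> and \<open>x\<close> lie in the
    center. If they differed, the former would be \<open>z \<otimes> (x \<otimes> x)\<close>, that
    is \<open>(x \<otimes> r) \<otimes> (r \<otimes> x)\<close>, and cancelling would make
    \<open>x\<close> and \<open>r\<close> commute.\<close>
  have inverts: "x \<otimes> r = inv r \<otimes> x" if x: "x \<in> carrier G" "x \<otimes> r \<noteq> r \<otimes> x" for x
  proof -
    have "(r \<otimes> x) \<otimes> (r \<otimes> x) = x \<otimes> x"
    proof (rule ccontr)
      assume "(r \<otimes> x) \<otimes> (r \<otimes> x) \<noteq> x \<otimes> x"
      then have "(r \<otimes> x) \<otimes> (r \<otimes> x) = z \<otimes> (x \<otimes> x)"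
        using square[of x] square[of "r \<otimes> x"] x rs zG zz by auto
      also have "\<dots> = (x \<otimes> r) \<otimes> (r \<otimes> x)"
        using x rs center_left_commute[OF z(1), of x x] by (simp add: m_assoc flip: rr)
      finally show False
        using x rs by simp
    qed
    then have "r \<otimes> (x \<otimes> r) = x"
      using x rs by (simp flip: m_assoc)
    then have "inv r \<otimes> (r \<otimes> (x \<otimes> r)) = inv r \<otimes> x" by simp
    then show ?thesis
      using x rs by simp
  qed
  have "r [^] (2 :: nat) = z"
    using rs rr by (simp add: numeral_2_eq_2)
  moreover from this have "r [^] (4 :: nat) = \<one>"
    using nat_pow_mult[of r 2 2] rs zz by simp
  ultimately have ord: "ord r = 4"
    using rs z by (intro ord_eq_4) auto
  have "\<exists>i :: int. x = r [^] i" if "x \<in> carrier G" "x \<otimes> r = r \<otimes> x" for x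
  proof -
    have "z = r [^] (2 :: int)" "r = r [^] (1 :: int)" "r \<otimes> z = r [^] (3 :: int)" "\<one> = r [^] (0 :: int)"
      using rs int_pow_mult[of r 1 1] int_pow_mult[of r 1 2] by (simp_all flip: rr)
    then show ?thesis
      using cent[OF r, of x] that by (metis insertE singletonD)
  qed
  \<comment> \<open>Only the exponent \<open>k\<close> is left open: 0 if \<open>s\<close> is an
    involution, and 2 if its square is \<open>z\<close>.\<close>
  note iso = iso_dicyclic_if_inverting[OF rs(1,2) inverts[OF rs(2,3)] rs(3) _ ord _ this inverts]
  have "s \<otimes> s = r [^] (0 :: nat) \<or> s \<otimes> s = r [^] (2 :: nat)"
    using square[of s] rs \<open>r [^] (2 :: nat) = z\<close> by simp
  then show ?thesis
    by (rule disj_forward; intro iso) simp_all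
qed

section \<open>Trivial center\<close>

text \<open>If \<open>x\<close> differs from its inverse, a further \<open>y\<close> forms a
  triangle with \<open>x\<close> and \<open>inv x\<close>. If \<open>x\<close> is an involution, the
  triangle is \<open>x\<close>, \<open>y\<close>, \<open>y \<otimes> x\<close> instead.\<close>

lemma centerless_centralizer:
  assumes center: "center G = {\<one>}" and x: "x \<in> carrier G" "x \<noteq> \<one>"
    and y: "y \<in> carrier G" "x \<otimes> y = y \<otimes> x"
  shows "y \<in> {\<one>, x, inv x}"
proof (rule ccontr)
  assume *: "y \<notin> {\<one>, x, inv x}"
  show False
  proof (cases "inv x = x")
    case False
    have "x \<otimes> y \<noteq> y \<otimes> x"
    proof (rule no_triangle[of x "inv x" y])
      show "inv x \<otimes> y = y \<otimes> inv x"
        using x(1) y by (simp add: commutes_inv_iff)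
    qed (use * False x y(1) in \<open>auto simp: center\<close>)
    with y show False by simp
  next
    case True
    have neq: "y \<otimes> x \<noteq> \<one>"
    proof
      assume "y \<otimes> x = \<one>"
      then have "inv x = y"
        using x(1) y(1) by (rule inv_equality)
      with * show False by simp
    qed
    have "x \<otimes> (y \<otimes> x) \<noteq> (y \<otimes> x) \<otimes> x"
    proof (rule no_triangle[of x y "y \<otimes> x"])
      show "y \<otimes> (y \<otimes> x) = (y \<otimes> x) \<otimes> y"
        using x(1) y(1) by (simp add: m_assoc y(2))
    qed (use * neq x y in \<open>auto simp: center\<close>)
    moreover have "x \<otimes> (y \<otimes> x) = (y \<otimes> x) \<otimes> x"
      using x(1) y(1) by (simp add: y(2) flip: m_assoc)
    ultimately show False by blast
  qed
qed

text \<open>The square of \<open>x\<close> centralizes \<open>x\<close>, so for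
  \<open>x \<noteq> \<one>\<close> it is \<open>\<one>\<close> or \<open>inv x\<close>.\<close>

lemma centerless_order:
  assumes "center G = {\<one>}" "x \<in> carrier G"
  shows "x \<otimes> x = \<one> \<or> x \<otimes> x \<otimes> x = \<one>"
proof (cases "x = \<one>")
  case False
  then have "x \<otimes> x \<in> {\<one>, x, inv x}"
    using assms by (intro centerless_centralizer) (auto simp: m_assoc)
  moreover have "x \<otimes> x \<noteq> x"
    using assms(2) False by simp
  moreover have "x \<otimes> x \<otimes> x = \<one>" if "x \<otimes> x = inv x"
    unfolding that using assms(2) by simp
  ultimately show ?thesis by blast
qed simp

text \<open>In a group of exponent 3 conjugate elements commute, so without a center every element
  would invert or centralize every other one; being a square, it would centralize it.\<close>

lemma centerless_involution:
  assumes center: "center G = {\<one>}" and x: "x \<in> carrier G" "x \<noteq> \<one>"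
  shows "\<exists>t. t \<in> carrier G \<and> t \<noteq> \<one> \<and> t \<otimes> t = \<one>"
proof (rule ccontr)
  assume "\<nexists>t. t \<in> carrier G \<and> t \<noteq> \<one> \<and> t \<otimes> t = \<one>"
  then have cube: "g \<otimes> (g \<otimes> g) = \<one>" if "g \<in> carrier G" for g
    using centerless_order[OF center that] that by (auto simp: m_assoc)
  \<comment> \<open>This is the cube of \<open>g \<otimes> h\<close> being trivial, solved for its
    first three factors.\<close>
  have sandwich: "g \<otimes> h \<otimes> g = inv h \<otimes> inv g \<otimes> inv h" if "g \<in> carrier G" "h \<in> carrier G" for g h
  proof -
    have "(g \<otimes> h \<otimes> g) \<otimes> (h \<otimes> g \<otimes> h) = \<one>"
      using cube[of "g \<otimes> h"] that by (simp add: m_assoc)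
    then have "g \<otimes> h \<otimes> g = inv (h \<otimes> g \<otimes> h)"
      using that by (intro inv_equality[symmetric]) auto
    then show ?thesis
      using that by (simp add: inv_mult_group m_assoc)
  qed
  have inv_sq: "inv g = g \<otimes> g" if "g \<in> carrier G" for g
    using cube[OF that] that by (intro inv_equality) (auto simp: m_assoc)
  obtain y where y: "y \<in> carrier G" "y \<otimes> x \<noteq> x \<otimes> y"
    using x center by (metis not_centralE singletonD)
  \<comment> \<open>The computation applies \<open>sandwich\<close> twice, first to
    \<open>y\<close>, \<open>x\<close> and then backwards to \<open>inv y\<close>, \<open>x\<close>,
    and uses that inverses are squares.\<close>
  let ?c = "y \<otimes> x \<otimes> inv y"
  have "x \<otimes> ?c = x \<otimes> (y \<otimes> x \<otimes> y) \<otimes> y"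
    using x y by (simp add: inv_sq m_assoc)
  also have "\<dots> = inv y \<otimes> inv x \<otimes> y"
    unfolding sandwich[OF y(1) x(1)] using x(1) y(1) by (simp add: m_assoc)
  also have "\<dots> = inv y \<otimes> (inv x \<otimes> inv (inv y) \<otimes> inv x) \<otimes> x"
    using x y by (simp add: m_assoc)
  also have "\<dots> = inv y \<otimes> (inv y \<otimes> x \<otimes> inv y) \<otimes> x"
    using sandwich[of "inv y" x] x(1) y(1) by simp
  also have "\<dots> = (inv y \<otimes> inv y) \<otimes> x \<otimes> inv y \<otimes> x"
    using x y by (simp add: m_assoc)
  also have "inv y \<otimes> inv y = y"
    using y inv_sq[of "inv y"] by simp
  finally have "x \<otimes> ?c = ?c \<otimes> x" .
  then have "?c \<in> {\<one>, x, inv x}"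
    using x y by (intro centerless_centralizer[OF center]) auto
  moreover have "?c \<noteq> \<one>" "?c \<noteq> x"
    using x y conj_commutes_iff[of y x] by (auto simp: inv_solve_right')
  ultimately have "?c = inv x" by blast
  then have "y \<otimes> x = inv x \<otimes> y"
    using x y by (metis inv_solve_right' inv_closed m_closed)
  \<comment> \<open>As \<open>inv y\<close> is the square of \<open>y\<close>, it inverts
    \<open>x\<close> twice.\<close>
  then have "inv y \<otimes> x = x \<otimes> inv y"
    using inverting_int_pow[of x y "-1"] x y
    by (simp add: inv_sq[of y] m_assoc int_pow_neg) (simp flip: m_assoc)
  then show False
    using x y by (simp add: commutes_inv_iff)
qed

text \<open>If \<open>t\<close> did not invert \<open>r\<close>, then \<open>t \<otimes> r\<close>
  would have order 3. The resulting relations are those of the alternating group A_4, whose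
  involutions commute; so \<open>t\<close> would commute with its conjugate under \<open>r\<close>,
  which is too much for its centralizer.\<close>

lemma centerless_inverts:
  assumes center: "center G = {\<one>}"
    and t: "t \<in> carrier G" "t \<noteq> \<one>" "t \<otimes> t = \<one>"
    and r: "r \<in> carrier G" "r \<noteq> \<one>" "r \<otimes> r \<otimes> r = \<one>"
  shows "t \<otimes> r = inv r \<otimes> t" and "t \<otimes> r \<noteq> r \<otimes> t"
proof -
  have inv_t: "inv t = t"
    using t by (simp add: inv_eq_self)
  show ncomm: "t \<otimes> r \<noteq> r \<otimes> t"
  proof
    assume "t \<otimes> r = r \<otimes> t"
    then have "r = t"
      using centerless_centralizer[OF center t(1,2) r(1)] r inv_t by auto
    then show False using t r by simp
  qed
  show "t \<otimes> r = inv r \<otimes> t"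
  proof (rule ccontr)
    assume "t \<otimes> r \<noteq> inv r \<otimes> t"
    then have cube: "(t \<otimes> r) \<otimes> (t \<otimes> r) \<otimes> (t \<otimes> r) = \<one>"
      using centerless_order[OF center, of "t \<otimes> r"] involution_prod t r by blast
    have inv_r: "inv r = r \<otimes> r"
      using r by (intro inv_equality) (auto simp: m_assoc)
    have "(r \<otimes> t \<otimes> r) \<otimes> (t \<otimes> r \<otimes> t) = \<one>"
    proof -
      \<comment> \<open>Conjugating by \<open>t\<close> turns the product into the cube of
        \<open>t \<otimes> r\<close>.\<close>
      have "t \<otimes> ((r \<otimes> t \<otimes> r) \<otimes> (t \<otimes> r \<otimes> t)) \<otimes> inv t = \<one>"
        using cube t r inv_t by (simp add: m_assoc)
      then show ?thesis
        using t r by (metis inv_closed inv_inv l_one m_assoc m_closed r_inv r_one inv_solve_right inv_comm inv_t)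
    qed
    then have rtr: "r \<otimes> t \<otimes> r = t \<otimes> inv r \<otimes> t"
      using t r inv_t inv_equality[of "r \<otimes> t \<otimes> r" "t \<otimes> r \<otimes> t"] by (simp add: inv_mult_group m_assoc)
    \<comment> \<open>Two uses of \<open>rtr\<close> turn \<open>?u \<otimes> t\<close> into
      \<open>t \<otimes> ?u\<close>.\<close>
    let ?u = "r \<otimes> t \<otimes> inv r"
    have "?u \<otimes> t = r \<otimes> (t \<otimes> inv r \<otimes> t)"
      using t r by (simp add: m_assoc)
    also have "t \<otimes> inv r \<otimes> t = r \<otimes> t \<otimes> r"
      by (rule rtr[symmetric])
    also have "r \<otimes> (r \<otimes> t \<otimes> r) = inv r \<otimes> t \<otimes> r"
      using t r by (simp add: inv_r m_assoc)
    also have "\<dots> = t \<otimes> (t \<otimes> inv r \<otimes> t) \<otimes> r"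
      using t r by (simp flip: m_assoc)
    also have "t \<otimes> inv r \<otimes> t = r \<otimes> t \<otimes> r"
      by (rule rtr[symmetric])
    also have "t \<otimes> (r \<otimes> t \<otimes> r) \<otimes> r = t \<otimes> ?u"
      using t r by (simp add: inv_r m_assoc)
    finally have "?u \<in> {\<one>, t, inv t}"
      using t r by (intro centerless_centralizer[OF center]) auto
    then have "?u = \<one> \<or> ?u = t"
      using inv_t by auto
    then show False
      using t r ncomm conj_commutes_iff[of r t] by (auto simp: inv_solve_right')
  qed
qed

text \<open>With \<open>r\<close> of order 3 and an involution \<open>t\<close>, it remains to see
  that every \<open>x\<close> not commuting with \<open>r\<close> inverts it. Involutions do so, and
  an \<open>x\<close> of order 3 would have to commute with \<open>r\<close>.\<close>

lemma iso_dicyclic_3: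
  assumes nonabelian: "x0 \<in> carrier G - center G" and center: "center G = {\<one>}"
  shows "G \<cong> dicyclic 3 0"
proof -
  obtain t where t: "t \<in> carrier G" "t \<noteq> \<one>" "t \<otimes> t = \<one>"
    using centerless_involution[OF center, of x0] nonabelian center by auto
  obtain y where y: "y \<in> carrier G" "t \<otimes> y \<noteq> y \<otimes> t"
    using t center by (metis not_centralE singletonD)
  \<comment> \<open>If \<open>y\<close> and \<open>t \<otimes> y\<close> both had trivial square,
    \<open>t\<close> and \<open>y\<close> would commute.\<close>
  obtain r where r: "r \<in> carrier G" "r \<otimes> r \<noteq> \<one>"
    using involution_prod[of t y] inv_eq_self[of y] y t by (metis m_closed)
  then have r3: "r \<noteq> \<one>" "r \<otimes> r \<otimes> r = \<one>"
    using centerless_order[OF center, of r] by auto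
  note inverts = centerless_inverts[OF center]
  have tr: "t \<otimes> r = inv r \<otimes> t" "t \<otimes> r \<noteq> r \<otimes> t"
    using inverts[OF t r(1) r3] by auto
  show ?thesis
  proof (rule iso_dicyclic_if_inverting[OF r(1) t(1) tr])
    show "ord r = 3"
      using r r3 by (intro ord_eq_3) (auto simp: numeral_3_eq_3)
  next
    fix x assume x: "x \<in> carrier G" "x \<otimes> r = r \<otimes> x"
    then have "x \<in> {\<one>, r, inv r}"
      using r r3 by (intro centerless_centralizer[OF center]) auto
    moreover have "\<one> = r [^] (0 :: int)" "r = r [^] (1 :: int)" "inv r = r [^] (-1 :: int)"
      using r by (simp_all add: int_pow_neg)
    ultimately show "\<exists>i :: int. x = r [^] i"
      by (metis insertE singletonD)
  next
    fix x assume x: "x \<in> carrier G" "x \<otimes> r \<noteq> r \<otimes> x"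
    then have "x \<noteq> \<one>" using r by auto
    show "x \<otimes> r = inv r \<otimes> x"
    proof (cases "x \<otimes> x = \<one>")
      case True
      then show ?thesis
        using inverts x r r3 \<open>x \<noteq> \<one>\<close> by blast
    next
      case False
      then have x3: "x \<otimes> x \<otimes> x = \<one>"
        using centerless_order[OF center x(1)] by auto
      \<comment> \<open>both involutions \<open>t\<close> and \<open>r t\<close> invert \<open>x\<close>, hence \<open>r\<close> centralizes it\<close>
      have rt1: "r \<otimes> t \<noteq> \<one>"
        using r t tr by (metis inv_equality)
      have rt2: "(r \<otimes> t) \<otimes> (r \<otimes> t) = \<one>"
      proof -
        have "(r \<otimes> t) \<otimes> (r \<otimes> t) = r \<otimes> (t \<otimes> r) \<otimes> t"
          using r t by (simp add: m_assoc)
        also have "\<dots> = \<one>"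
          unfolding tr(1) using r(1) t by (simp add: m_assoc)
        finally show ?thesis .
      qed
      have "(r \<otimes> t) \<otimes> x = inv x \<otimes> (r \<otimes> t)"
        using inverts(1)[OF m_closed[OF r(1) t(1)] rt1 rt2 x(1) \<open>x \<noteq> \<one>\<close> x3] .
      moreover have "(r \<otimes> t) \<otimes> x = (r \<otimes> inv x) \<otimes> t"
        using inverts(1)[OF t x(1) \<open>x \<noteq> \<one>\<close> x3] r(1) t(1) x(1) by (simp add: m_assoc)
      ultimately have "inv x \<otimes> r = r \<otimes> inv x"
        using r(1) t(1) x(1) by (simp flip: m_assoc)
      then show ?thesis
        using x r by (simp add: commutes_inv_iff)
    qed
  qed (use t in auto)
qed

end

section \<open>The converse and the conclusion\<close>

lemma iso_center_nontrivial:
  assumes "group G" "group H" "G \<cong> H" "z \<in> center H" "z \<noteq> \<one>\<^bsub>H\<^esub>"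
  shows "\<exists>w \<in> center G. w \<noteq> \<one>\<^bsub>G\<^esub>"
proof -
  interpret G: group G by fact
  interpret H: group H by fact
  obtain h where h: "h \<in> iso H G"
    using G.iso_sym[OF \<open>G \<cong> H\<close>] by (auto simp: is_iso_def)
  then have hom: "h \<in> hom H G" by (rule iso_imp_homomorphism)
  have surj: "h ` carrier H = carrier G" and inj: "inj_on h (carrier H)"
    using h unfolding iso_iff by blast+
  have z: "z \<in> carrier H" "\<And>x. x \<in> carrier H \<Longrightarrow> z \<otimes>\<^bsub>H\<^esub> x = x \<otimes>\<^bsub>H\<^esub> z"
    using assms by (auto simp: center_def)
  have "h z \<otimes>\<^bsub>G\<^esub> y = y \<otimes>\<^bsub>G\<^esub> h z" if y: "y \<in> carrier G" for y
  proof -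
    obtain x where "x \<in> carrier H" "y = h x"
      using y surj by blast
    then show ?thesis
      using z(2)[of x] hom_mult[OF hom z(1), of x] hom_mult[OF hom _ z(1), of x] by simp
  qed
  then have "h z \<in> center G"
    using hom_in_carrier[OF hom z(1)] by (simp add: center_def)
  moreover have "h z \<noteq> \<one>\<^bsub>G\<^esub>"
    using inj z(1) assms hom_one[OF hom] by (metis H.one_closed inj_onD)
  ultimately show ?thesis by blast
qed

text \<open>The center of \<open>G\<close> has at least two elements, and 8 < 2 * (2 + 3).\<close>

lemma (in group) no_3_cycle_if_order_8:
  assumes "group H" "G \<cong> H" "order H = 8" "z \<in> center H" "z \<noteq> \<one>\<^bsub>H\<^esub>"
  shows "\<not> has_3_cycle (commuting_graph G)"
proof -
  have order: "order G = 8"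
    using assms iso_same_card[of G H] by (simp add: order_def)
  then have fin: "finite (carrier G)"
    by (simp add: order_gt_0_iff_finite[symmetric])
  obtain w where "w \<in> center G" "w \<noteq> \<one>"
    using iso_center_nontrivial[OF group_axioms assms(1,2,4,5)] by blast
  then have "card {\<one>, w} \<le> card (center G)"
    using fin by (intro card_mono) (auto simp: center_def)
  with \<open>w \<noteq> \<one>\<close> order fin show ?thesis
    by (intro no_3_cycle_if_order_less) auto
qed

theorem proposition3p1:
  fixes G :: "('a, 'b) monoid_scheme"
  assumes "group G" and "\<not> comm_group G"
  shows "\<not> has_3_cycle (commuting_graph G) \<longleftrightarrow>
    G \<cong> sym_group 3 \<or> G \<cong> quaternion_group \<or> G \<cong> dihedral_group 4"
proof
  interpret group G by fact
  assume "\<not> has_3_cycle (commuting_graph G)"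
  then interpret triangle_free_group G
    by unfold_locales
  obtain x where x: "x \<in> carrier G - center G"
    using assms(2) group_comm_groupI by (auto simp: center_def)
  show "G \<cong> sym_group 3 \<or> G \<cong> quaternion_group \<or> G \<cong> dihedral_group 4"
  proof (cases "center G = {\<one>\<^bsub>G\<^esub>}")
    case True
    then show ?thesis
      using iso_dicyclic_3[OF x] sym_group_3_iso iso_trans by blast
  next
    case False
    then obtain z where "z \<in> center G" "z \<noteq> \<one>\<^bsub>G\<^esub>"
      using one_in_center by blast
    then show ?thesis
      using iso_dicyclic_4[OF x] quaternion_group_iso iso_trans unfolding dicyclic_0 by blast
  qed
next
  interpret group G by fact
  assume "G \<cong> sym_group 3 \<or> G \<cong> quaternion_group \<or> G \<cong> dihedral_group 4"
  then consider "G \<cong> sym_group 3" | "G \<cong> quaternion_group" | "G \<cong> dihedral_group 4"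
    by blast
  then show "\<not> has_3_cycle (commuting_graph G)"
  proof cases
    case 1
    then have order: "order G = 6"
      using iso_same_card[OF 1] order_sym_group_3 by (simp add: order_def)
    then have fin: "finite (carrier G)"
      by (simp add: order_gt_0_iff_finite[symmetric])
    \<comment> \<open>One central element suffices here, as 6 < 2 * (1 + 3).\<close>
    then have "card (center G) > 0"
      using one_in_center by (auto simp: card_gt_0_iff center_def)
    with order fin show ?thesis
      by (intro no_3_cycle_if_order_less) auto
  next
    case 2
    have "(-1, 0, 0, 0) \<in> center quaternion_group"
      by (simp add: center_def quaternion_group_def quaternion_mult_def)
    then show ?thesis
      by (rule no_3_cycle_if_order_8[OF group_quaternion_group 2 order_quaternion_group])
        (simp add: quaternion_group_def)
  next
    case 3
    \<comment> \<open>The square of the rotation is its own inverse, so the reflections commute with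
      it.\<close>
    have "(i - 2) mod 4 = (2 + i) mod 4" for i :: int
      by presburger
    then have "(2, False) \<in> center (dihedral_group 4)"
      by (simp add: center_def dihedral_group_def add.commute)
    then show ?thesis
      using no_3_cycle_if_order_8[OF group_dihedral_group 3]
      by (simp add: order_dihedral_group) (simp add: dihedral_group_def)
  qed
qed

end
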